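(* Let $S$ be an inverse semigroup. The inverse semigroup $\mathcal{L}(S)$ of closed directed subsets (directed cosets) of $S$ is isomorphic to Lenz's inverse semigroup $\mathcal{O}(S)$.
   Context: The order on $S$ is the natural partial order. For $A\subseteq S$, $A^{\uparrow}=\{s\in S: a\le s\text{ for some }a\in A\}$; $A$ is closed if $A=A^{\uparrow}$. A subset $A\subseteq S$ is (down) directed if it is non-empty and for all $a,b\in A$ there is $c\in A$ with $c\le a,b$. $\mathcal{L}(S)$ is the set of all closed directed subsets of $S$ (equivalently, the directed subsets $A$ that satisfy $A=A^{\uparrow}$ and $A=AA^{-1}A$) with the product $A\otimes B=(AB)^{\uparrow}$, where $AB=\{ab:a\in A,b\in B\}$; it is an inverse semigroup. Lenz's semigroup $\mathcal{O}(S)$: let $\mathcal{F}(S)$ be the set of all directed subsets of $S$. For $A,B\in\mathcal{F}(S)$ write $A\prec B$ iff for each $b\in B$ there exists $a\in A$ with $a\le b$; this is a preorder, and $A\sim B$ means $A\prec B$ and $B\prec A$. As a set $\mathcal{O}(S)=\mathcal{F}(S)/{\sim}$, and the multiplication is induced by the product of subsets: $[A][B]=[AB]$. *)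

theory Defs
  imports "HOL-Algebra.Coset"
begin

text \<open>
  Semigroups are represented by the \<^type>\<open>monoid_ext\<close> records of HOL-Algebra, so that
  \<^const>\<open>set_mult\<close>, \<^const>\<open>iso\<close> and \<^const>\<open>is_iso\<close> (which refer to the carrier and the
  multiplication only) can be used as they are. The unit field plays no role and is left
  undefined in the constructions below.
\<close>

locale inverse_semigroup =
  fixes S (structure)
  assumes mult_closed: "\<lbrakk>a \<in> carrier S; b \<in> carrier S\<rbrakk> \<Longrightarrow> a \<otimes> b \<in> carrier S"
    and mult_assoc: "\<lbrakk>a \<in> carrier S; b \<in> carrier S; c \<in> carrier S\<rbrakk>
      \<Longrightarrow> (a \<otimes> b) \<otimes> c = a \<otimes> (b \<otimes> c)"
    and unique_inverse: "a \<in> carrier S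
      \<Longrightarrow> \<exists>!b. b \<in> carrier S \<and> a \<otimes> b \<otimes> a = a \<and> b \<otimes> a \<otimes> b = b"

definition natural_le :: "('a, 'm) monoid_scheme \<Rightarrow> 'a \<Rightarrow> 'a \<Rightarrow> bool" where
  "natural_le S a b \<longleftrightarrow> a \<in> carrier S \<and> b \<in> carrier S \<and>
     (\<exists>e\<in>carrier S. e \<otimes>\<^bsub>S\<^esub> e = e \<and> a = e \<otimes>\<^bsub>S\<^esub> b)"

definition up_closure :: "('a, 'm) monoid_scheme \<Rightarrow> 'a set \<Rightarrow> 'a set" where
  "up_closure S A = {s \<in> carrier S. \<exists>a\<in>A. natural_le S a s}"

definition directed_subsets :: "('a, 'm) monoid_scheme \<Rightarrow> 'a set set" where
  "directed_subsets S = {A. A \<subseteq> carrier S \<and> A \<noteq> {} \<and>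
     (\<forall>a\<in>A. \<forall>b\<in>A. \<exists>c\<in>A. natural_le S c a \<and> natural_le S c b)}"

definition closed_directed_semigroup :: "('a, 'm) monoid_scheme \<Rightarrow> 'a set monoid" where
  "closed_directed_semigroup S =
     \<lparr>carrier = {A \<in> directed_subsets S. up_closure S A = A},
      mult = (\<lambda>A B. up_closure S (A <#>\<^bsub>S\<^esub> B)),
      one = undefined\<rparr>"

definition lenz_prec :: "('a, 'm) monoid_scheme \<Rightarrow> 'a set \<Rightarrow> 'a set \<Rightarrow> bool" where
  "lenz_prec S A B \<longleftrightarrow> (\<forall>b\<in>B. \<exists>a\<in>A. natural_le S a b)"

definition lenz_rel :: "('a, 'm) monoid_scheme \<Rightarrow> ('a set \<times> 'a set) set" where
  "lenz_rel S = {(A, B). A \<in> directed_subsets S \<and> B \<in> directed_subsets S \<and>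
     lenz_prec S A B \<and> lenz_prec S B A}"

text \<open>
  The product of two classes is the union of the classes \<open>[AB]\<close> over all representatives \<open>A\<close>
  and \<open>B\<close>. As \<open>[AB]\<close> does not depend on the representatives, this is \<open>[A][B] = [AB]\<close>; a union
  of different classes would not be an element of the quotient.
\<close>

definition lenz_semigroup :: "('a, 'm) monoid_scheme \<Rightarrow> 'a set set monoid" where
  "lenz_semigroup S =
     \<lparr>carrier = directed_subsets S // lenz_rel S,
      mult = (\<lambda>X Y. \<Union>A\<in>X. \<Union>B\<in>Y. lenz_rel S `` {A <#>\<^bsub>S\<^esub> B}),
      one = undefined\<rparr>"

end

theory Submission imports Defs begin

text \<open>
  The preorder \<open>A \<prec> B\<close> of Lenz says that \<open>B \<subseteq> A\<^sup>\<up>\<close>, where \<open>A\<^sup>\<up>\<close> is the up-closure. Hence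
  \<open>A \<sim> B\<close> holds exactly if the two directed sets have the same up-closure, and each class
  contains exactly one closed set, namely \<open>A\<^sup>\<up>\<close>. Sending a closed directed set to its class is
  therefore a bijection (lemma \<open>class_iso\<close>). It respects products because the natural order is
  compatible with the multiplication, so that \<open>(AB)\<^sup>\<up>\<close> depends only on \<open>A\<^sup>\<up>\<close> and \<open>B\<^sup>\<up>\<close>.

  It remains to see that the closed directed sets form an inverse semigroup; the other structure
  inherits this along the isomorphism. Associativity comes from that of the product of subsets.
  The inverse of \<open>A\<close> is the set \<open>A\<^sup>-\<^sup>1\<close> of inverses: a product \<open>a b\<^sup>-\<^sup>1 c\<close> of members of \<open>A\<close>
  lies above \<open>d d\<^sup>-\<^sup>1 d = d\<close> for any lower bound \<open>d \<in> A\<close> of \<open>a\<close>, \<open>b\<close>, \<open>c\<close>. For uniqueness,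
  picture the elements as partial injections: if \<open>c\<close> is a restriction both of \<open>a\<close> and
  of \<open>a b a\<close>, then \<open>b\<close> undoes \<open>a\<close> on the domain of \<open>c\<close>, so \<open>c\<^sup>-\<^sup>1 \<le> b\<close>
  (lemma \<open>inverse_below\<close>). When \<open>B\<close> is an inverse of \<open>A\<close>, such a \<open>c \<in> A\<close> exists for
  all \<open>a \<in> A\<close> and \<open>b \<in> B\<close>, because \<open>a b a \<in> A\<close> and \<open>A\<close> is directed; this yields
  \<open>B \<subseteq> A\<^sup>-\<^sup>1\<close>, and exchanging the roles of \<open>A\<close> and \<open>B\<close> gives equality.
\<close>

section \<open>Inverse semigroups and the natural partial order\<close>

context inverse_semigroup
begin

definition sinv :: "'a \<Rightarrow> 'a" where
  "sinv a = (THE b. b \<in> carrier S \<and> a \<otimes> b \<otimes> a = a \<and> b \<otimes> a \<otimes> b = b)"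

abbreviation idem :: "'a \<Rightarrow> bool" where
  "idem e \<equiv> e \<in> carrier S \<and> e \<otimes> e = e"

abbreviation le :: "'a \<Rightarrow> 'a \<Rightarrow> bool" (infix "\<preceq>" 50) where
  "a \<preceq> b \<equiv> natural_le S a b"

abbreviation up :: "'a set \<Rightarrow> 'a set" where
  "up \<equiv> up_closure S"

abbreviation directed :: "'a set set" where
  "directed \<equiv> directed_subsets S"

lemma sinv:
  assumes "a \<in> carrier S"
  shows sinv_closed: "sinv a \<in> carrier S"
    and mult_sinv_mult: "a \<otimes> sinv a \<otimes> a = a"
    and sinv_mult_sinv: "sinv a \<otimes> a \<otimes> sinv a = sinv a"
  using theI'[OF unique_inverse[OF assms]] unfolding sinv_def by auto

lemmas semigroup_simps = mult_closed mult_assoc sinv_closed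

lemma sinv_eqI:
  assumes "a \<in> carrier S" "b \<in> carrier S" "a \<otimes> b \<otimes> a = a" "b \<otimes> a \<otimes> b = b"
  shows "sinv a = b"
  using unique_inverse[OF assms(1)] assms sinv[OF assms(1)] by blast

lemma sinv_sinv: "a \<in> carrier S \<Longrightarrow> sinv (sinv a) = a"
  by (rule sinv_eqI) (simp_all add: sinv)

lemma sinv_idem: "idem e \<Longrightarrow> sinv e = e"
  by (rule sinv_eqI) simp_all

lemma idem_absorb: "idem e \<Longrightarrow> x \<in> carrier S \<Longrightarrow> e \<otimes> (e \<otimes> x) = e \<otimes> x"
  by (metis mult_assoc)

text \<open>
  If \<open>x\<close> is the inverse of \<open>e f\<close>, then so is \<open>f x e\<close>, which is visibly idempotent. Hence \<open>x\<close>
  is idempotent and equals its own inverse \<open>e f\<close>.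
\<close>

lemma idem_mult:
  assumes e: "idem e" and f: "idem f"
  shows "idem (e \<otimes> f)"
proof -
  define x where "x = sinv (e \<otimes> f)"
  have ef: "e \<otimes> f \<in> carrier S" using e f mult_closed by blast
  have x: "x \<in> carrier S" unfolding x_def using ef by (rule sinv_closed)
  have 1: "e \<otimes> (f \<otimes> (x \<otimes> (e \<otimes> f))) = e \<otimes> f"
    using mult_sinv_mult[OF ef] e f x by (simp add: x_def[symmetric] semigroup_simps)
  have 2: "x \<otimes> (e \<otimes> (f \<otimes> x)) = x"
    using sinv_mult_sinv[OF ef] e f x by (simp add: x_def[symmetric] semigroup_simps)
  have 3: "x \<otimes> (e \<otimes> (f \<otimes> (x \<otimes> y))) = x \<otimes> y" if "y \<in> carrier S" for y
    using arg_cong[OF 2, of "\<lambda>z. z \<otimes> y"] that e f x by (simp add: semigroup_simps)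
  have "x = f \<otimes> (x \<otimes> e)" unfolding x_def
    by (rule sinv_eqI)
      (use e f x 1 3 in \<open>simp_all add: x_def[symmetric] semigroup_simps idem_absorb\<close>)
  moreover have "(f \<otimes> (x \<otimes> e)) \<otimes> (f \<otimes> (x \<otimes> e)) = f \<otimes> (x \<otimes> e)"
    using e f x 3 by (simp add: semigroup_simps)
  ultimately have "idem x" using x by simp
  moreover have "x = e \<otimes> f" using sinv_sinv[OF ef] sinv_idem[OF \<open>idem x\<close>] x_def by simp
  ultimately show ?thesis by simp
qed

text \<open>
  Both products are idempotent, which makes each of them an inverse of \<open>e f\<close>; inverses being
  unique, they coincide.
\<close>

lemma idem_commute:
  assumes e: "idem e" and f: "idem f"
  shows "e \<otimes> f = f \<otimes> e"
proof -
  have ef: "idem (e \<otimes> f)" and fe: "idem (f \<otimes> e)" using idem_mult e f by auto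
  have "sinv (e \<otimes> f) = f \<otimes> e"
    by (rule sinv_eqI) (use ef fe e f in \<open>simp_all add: semigroup_simps idem_absorb\<close>)
  then show ?thesis using sinv_idem[OF ef] by simp
qed

lemma idem_mult_sinv: "a \<in> carrier S \<Longrightarrow> idem (a \<otimes> sinv a)"
  by (metis mult_assoc mult_closed sinv_closed mult_sinv_mult)

lemma idem_sinv_mult: "a \<in> carrier S \<Longrightarrow> idem (sinv a \<otimes> a)"
  by (metis mult_assoc mult_closed sinv_closed sinv_mult_sinv)

lemma sinv_mult:
  assumes a: "a \<in> carrier S" and b: "b \<in> carrier S"
  shows "sinv (a \<otimes> b) = sinv b \<otimes> sinv a"
proof (rule sinv_eqI)
  note c = a b sinv_closed[OF a] sinv_closed[OF b]
  have comm: "(sinv a \<otimes> a) \<otimes> (b \<otimes> sinv b) = (b \<otimes> sinv b) \<otimes> (sinv a \<otimes> a)"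
    using idem_commute idem_mult_sinv[OF b] idem_sinv_mult[OF a] by blast
  have "a \<otimes> b \<otimes> (sinv b \<otimes> sinv a) \<otimes> (a \<otimes> b)
    = a \<otimes> ((b \<otimes> sinv b) \<otimes> (sinv a \<otimes> a)) \<otimes> b"
    using c by (simp add: semigroup_simps)
  also have "\<dots> = (a \<otimes> sinv a \<otimes> a) \<otimes> (b \<otimes> sinv b \<otimes> b)"
    unfolding comm[symmetric] using c by (simp add: semigroup_simps)
  finally show "a \<otimes> b \<otimes> (sinv b \<otimes> sinv a) \<otimes> (a \<otimes> b) = a \<otimes> b"
    using a b by (simp add: sinv)
  have "sinv b \<otimes> sinv a \<otimes> (a \<otimes> b) \<otimes> (sinv b \<otimes> sinv a)
    = sinv b \<otimes> ((sinv a \<otimes> a) \<otimes> (b \<otimes> sinv b)) \<otimes> sinv a"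
    using c by (simp add: semigroup_simps)
  also have "\<dots> = (sinv b \<otimes> b \<otimes> sinv b) \<otimes> (sinv a \<otimes> a \<otimes> sinv a)"
    unfolding comm using c by (simp add: semigroup_simps)
  finally show "sinv b \<otimes> sinv a \<otimes> (a \<otimes> b) \<otimes> (sinv b \<otimes> sinv a) = sinv b \<otimes> sinv a"
    using a b by (simp add: sinv)
qed (use a b in \<open>simp_all add: semigroup_simps\<close>)

lemma le_carrier: "a \<preceq> b \<Longrightarrow> a \<in> carrier S \<and> b \<in> carrier S"
  by (simp add: natural_le_def)

lemma le_idem_mult: "idem e \<Longrightarrow> b \<in> carrier S \<Longrightarrow> e \<otimes> b \<preceq> b"
  by (auto simp: natural_le_def mult_closed)

text \<open>
  The natural order, defined by an idempotent on the left, does not depend on the side: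
  an idempotent can be moved across \<open>b\<close> at the cost of conjugating it by \<open>b\<close>. Compatibility with
  multiplication from both sides rests on this.
\<close>

lemma le_mult_idem:
  assumes b: "b \<in> carrier S" and f: "idem f"
  shows "b \<otimes> f \<preceq> b"
proof -
  let ?e = "b \<otimes> f \<otimes> sinv b"
  note c = b f sinv_closed[OF b]
  have comm: "f \<otimes> (sinv b \<otimes> b) = (sinv b \<otimes> b) \<otimes> f"
    using idem_commute f idem_sinv_mult[OF b] by blast
  have bf: "?e \<otimes> b = b \<otimes> f"
  proof -
    have "?e \<otimes> b = b \<otimes> (f \<otimes> (sinv b \<otimes> b))" using c by (simp add: semigroup_simps)
    also have "\<dots> = (b \<otimes> sinv b \<otimes> b) \<otimes> f" unfolding comm using c by (simp add: semigroup_simps)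
    finally show ?thesis using b by (simp add: sinv)
  qed
  have "?e \<otimes> ?e = (?e \<otimes> b) \<otimes> (f \<otimes> sinv b)" using c by (simp add: semigroup_simps)
  also have "\<dots> = ?e" unfolding bf using c by (simp add: semigroup_simps idem_absorb)
  finally have "idem ?e" using c by (simp add: semigroup_simps)
  from le_idem_mult[OF this b] show ?thesis unfolding bf .
qed

lemma le_right_factor:
  assumes "a \<preceq> b"
  obtains f where "idem f" "a = b \<otimes> f"
proof -
  from assms obtain e where e: "idem e" and a: "a = e \<otimes> b" and b: "b \<in> carrier S"
    by (auto simp: natural_le_def)
  let ?f = "sinv b \<otimes> e \<otimes> b"
  note c = b e sinv_closed[OF b]
  have comm: "(b \<otimes> sinv b) \<otimes> e = e \<otimes> (b \<otimes> sinv b)"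
    using idem_commute e idem_mult_sinv[OF b] by blast
  have bf: "b \<otimes> ?f = e \<otimes> b"
  proof -
    have "b \<otimes> ?f = ((b \<otimes> sinv b) \<otimes> e) \<otimes> b" using c by (simp add: semigroup_simps)
    also have "\<dots> = e \<otimes> (b \<otimes> sinv b \<otimes> b)" unfolding comm using c by (simp add: semigroup_simps)
    finally show ?thesis using b by (simp add: sinv)
  qed
  have "?f \<otimes> ?f = (sinv b \<otimes> e) \<otimes> (b \<otimes> ?f)" using c by (simp add: semigroup_simps)
  also have "\<dots> = ?f" unfolding bf using c by (simp add: semigroup_simps idem_absorb)
  finally have "idem ?f" using c by (simp add: semigroup_simps)
  then show thesis using that bf a by simp
qed

lemma le_refl: "a \<in> carrier S \<Longrightarrow> a \<preceq> a"
  using le_idem_mult[OF idem_mult_sinv, of a a] by (simp add: sinv)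

lemma le_trans:
  assumes "a \<preceq> b" "b \<preceq> c"
  shows "a \<preceq> c"
proof -
  from assms obtain e f where e: "idem e" "a = e \<otimes> b" and f: "idem f" "b = f \<otimes> c"
    and c: "c \<in> carrier S" by (auto simp: natural_le_def)
  have "a = (e \<otimes> f) \<otimes> c" using e f c by (simp add: mult_assoc)
  then show ?thesis using le_idem_mult[OF idem_mult[OF e(1) f(1)] c] by simp
qed

lemma mult_mono:
  assumes "a \<preceq> b" "c \<preceq> d"
  shows "a \<otimes> c \<preceq> b \<otimes> d"
proof -
  from assms(1) obtain e where e: "idem e" "a = e \<otimes> b" by (auto simp: natural_le_def)
  from assms(2) obtain f where f: "idem f" "c = d \<otimes> f" by (rule le_right_factor)
  have cs: "b \<in> carrier S" "c \<in> carrier S" "d \<in> carrier S" using assms le_carrier by auto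
  have "a \<otimes> c = e \<otimes> (b \<otimes> c)" using e cs by (simp add: mult_assoc)
  then have "a \<otimes> c \<preceq> b \<otimes> c" using le_idem_mult e(1) cs mult_closed by simp
  moreover have "b \<otimes> c = (b \<otimes> d) \<otimes> f" using f cs by (simp add: mult_assoc)
  then have "b \<otimes> c \<preceq> b \<otimes> d" using le_mult_idem f(1) cs mult_closed by simp
  ultimately show ?thesis by (rule le_trans)
qed

lemma sinv_mono:
  assumes "a \<preceq> b"
  shows "sinv a \<preceq> sinv b"
proof -
  from assms obtain e where e: "idem e" "a = e \<otimes> b" and b: "b \<in> carrier S"
    by (auto simp: natural_le_def)
  then have "sinv a = sinv b \<otimes> e" by (simp add: sinv_mult sinv_idem)
  then show ?thesis using le_mult_idem e(1) sinv_closed[OF b] by simp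
qed

text \<open>
  Here \<open>c\<^sup>-\<^sup>1 = c\<^sup>-\<^sup>1 c c\<^sup>-\<^sup>1 \<le> a\<^sup>-\<^sup>1 (a b a) a\<^sup>-\<^sup>1\<close>, and the right-hand side is \<open>b\<close> multiplied by
  the idempotents \<open>a\<^sup>-\<^sup>1 a\<close> and \<open>a a\<^sup>-\<^sup>1\<close>. This one-sided substitute for inverseness is what
  makes inverses of directed sets unique.
\<close>

lemma inverse_below:
  assumes ca: "c \<preceq> a" and caba: "c \<preceq> a \<otimes> b \<otimes> a" and b: "b \<in> carrier S"
  shows "sinv c \<preceq> b"
proof -
  have a: "a \<in> carrier S" and c: "c \<in> carrier S" using ca le_carrier by auto
  note cs = a b c sinv_closed[OF a]
  have "sinv c \<otimes> c \<otimes> sinv c \<preceq> sinv a \<otimes> (a \<otimes> b \<otimes> a) \<otimes> sinv a"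
    by (intro mult_mono sinv_mono ca caba)
  also have "sinv a \<otimes> (a \<otimes> b \<otimes> a) \<otimes> sinv a = (sinv a \<otimes> a) \<otimes> (b \<otimes> (a \<otimes> sinv a))"
    using cs by (simp add: semigroup_simps)
  finally have "sinv c \<preceq> (sinv a \<otimes> a) \<otimes> (b \<otimes> (a \<otimes> sinv a))" using c by (simp add: sinv)
  also have "\<dots> \<preceq> b \<otimes> (a \<otimes> sinv a)"
    using cs idem_sinv_mult by (intro le_idem_mult) (simp_all add: semigroup_simps)
  also (le_trans) have "\<dots> \<preceq> b" by (intro le_mult_idem b idem_mult_sinv a)
  finally (le_trans) show ?thesis .
qed

section \<open>Up-closures, directed sets and their products\<close>

lemma up_subset_carrier: "up A \<subseteq> carrier S"
  by (auto simp: up_closure_def)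

lemma subset_up: "A \<subseteq> carrier S \<Longrightarrow> A \<subseteq> up A"
  using le_refl by (auto simp: up_closure_def)

lemma up_subset: "A \<subseteq> up B \<Longrightarrow> up A \<subseteq> up B"
  unfolding up_closure_def by (blast intro: le_trans)

lemma up_up: "A \<subseteq> carrier S \<Longrightarrow> up (up A) = up A"
  using up_subset[of "up A" A] subset_up[OF up_subset_carrier] by blast

lemma up_eq_iff:
  "A \<subseteq> carrier S \<Longrightarrow> B \<subseteq> carrier S \<Longrightarrow> up A = up B \<longleftrightarrow> A \<subseteq> up B \<and> B \<subseteq> up A"
  using up_subset subset_up by blast

lemma set_mult_iff: "x \<in> A <#> B \<longleftrightarrow> (\<exists>a\<in>A. \<exists>b\<in>B. x = a \<otimes> b)"
  by (auto simp: set_mult_def)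

lemma set_mult_triple_iff:
  "x \<in> A <#> B <#> C \<longleftrightarrow> (\<exists>a\<in>A. \<exists>b\<in>B. \<exists>c\<in>C. x = a \<otimes> b \<otimes> c)"
  by (simp add: set_mult_def)

lemma set_mult_subset_carrier:
  "A \<subseteq> carrier S \<Longrightarrow> B \<subseteq> carrier S \<Longrightarrow> A <#> B \<subseteq> carrier S"
  unfolding set_mult_def using mult_closed by blast

lemma set_mult_associative:
  assumes "A \<subseteq> carrier S" "B \<subseteq> carrier S" "C \<subseteq> carrier S"
  shows "(A <#> B) <#> C = A <#> (B <#> C)"
proof -
  have *: "(a \<otimes> b) \<otimes> c = a \<otimes> (b \<otimes> c)" if "a \<in> A" "b \<in> B" "c \<in> C" for a b c
    using that assms mult_assoc by blast
  have "x \<in> A <#> (B <#> C) \<longleftrightarrow> (\<exists>a\<in>A. \<exists>b\<in>B. \<exists>c\<in>C. x = a \<otimes> (b \<otimes> c))" for x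
    by (simp add: set_mult_def)
  then show ?thesis using * by (auto simp: set_mult_triple_iff)
qed

lemma set_mult_subset_up:
  assumes "A' \<subseteq> up A" "B' \<subseteq> up B"
  shows "A' <#> B' \<subseteq> up (A <#> B)"
proof
  fix x assume "x \<in> A' <#> B'"
  then obtain a' b' where x: "x = a' \<otimes> b'" and ab': "a' \<in> A'" "b' \<in> B'"
    by (auto simp: set_mult_iff)
  then obtain a b where ab: "a \<in> A" "b \<in> B" and le: "a \<preceq> a'" "b \<preceq> b'"
    using assms unfolding up_closure_def by blast
  have "a \<otimes> b \<preceq> x" unfolding x using le by (rule mult_mono)
  moreover have "a \<otimes> b \<in> A <#> B" using ab by (auto simp: set_mult_iff)
  ultimately show "x \<in> up (A <#> B)" using le_carrier by (auto simp: up_closure_def)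
qed

lemma up_set_mult_cong:
  assumes "A \<subseteq> carrier S" "B \<subseteq> carrier S" "A' \<subseteq> carrier S" "B' \<subseteq> carrier S"
    and "up A = up A'" "up B = up B'"
  shows "up (A <#> B) = up (A' <#> B')"
  using assms by (simp add: up_eq_iff set_mult_subset_carrier set_mult_subset_up)

lemma directed_carrier: "A \<in> directed \<Longrightarrow> A \<subseteq> carrier S"
  by (simp add: directed_subsets_def)

lemma directed_nonempty: "A \<in> directed \<Longrightarrow> \<exists>a. a \<in> A"
  by (auto simp: directed_subsets_def)

lemma directed_lower_bound:
  assumes "A \<in> directed" "a \<in> A" "b \<in> A"
  obtains c where "c \<in> A" "c \<preceq> a" "c \<preceq> b"
  using assms unfolding directed_subsets_def by blast

lemma directed_up:
  assumes A: "A \<in> directed"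
  shows "up A \<in> directed"
  unfolding directed_subsets_def
proof (intro CollectI conjI ballI up_subset_carrier)
  show "up A \<noteq> {}" using directed_nonempty[OF A] subset_up[OF directed_carrier[OF A]] by blast
  fix x y assume "x \<in> up A" "y \<in> up A"
  then obtain a b where "a \<in> A" "b \<in> A" and le: "a \<preceq> x" "b \<preceq> y" by (auto simp: up_closure_def)
  then obtain c where "c \<in> A" "c \<preceq> a" "c \<preceq> b" using A directed_lower_bound by blast
  then show "\<exists>c\<in>up A. c \<preceq> x \<and> c \<preceq> y"
    using le le_trans subset_up[OF directed_carrier[OF A]] by blast
qed

lemma directed_set_mult:
  assumes A: "A \<in> directed" and B: "B \<in> directed"
  shows "A <#> B \<in> directed"
  unfolding directed_subsets_def
proof (intro CollectI conjI ballI)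
  show "A <#> B \<subseteq> carrier S"
    using A B directed_carrier set_mult_subset_carrier by blast
  show "A <#> B \<noteq> {}"
    using directed_nonempty[OF A] directed_nonempty[OF B] by (auto simp: set_mult_def)
  fix x y assume "x \<in> A <#> B" "y \<in> A <#> B"
  then obtain a b a' b' where "a \<in> A" "b \<in> B" "a' \<in> A" "b' \<in> B"
    and xy: "x = a \<otimes> b" "y = a' \<otimes> b'" by (auto simp: set_mult_iff)
  moreover from this obtain c where "c \<in> A" "c \<preceq> a" "c \<preceq> a'"
    using A directed_lower_bound by blast
  moreover from calculation obtain d where "d \<in> B" "d \<preceq> b" "d \<preceq> b'"
    using B directed_lower_bound by blast
  ultimately show "\<exists>z\<in>A <#> B. z \<preceq> x \<and> z \<preceq> y"
    by (intro bexI[of _ "c \<otimes> d"]) (auto simp: set_mult_iff intro: mult_mono)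
qed

section \<open>The inverse semigroup of closed directed sets\<close>

abbreviation closed_directed :: "'a set set" where
  "closed_directed \<equiv> {A \<in> directed. up A = A}"

lemma up_mem: "up A = A \<Longrightarrow> a \<in> A \<Longrightarrow> a \<preceq> b \<Longrightarrow> b \<in> A"
  using le_carrier[of a b] by (auto simp: up_closure_def)

lemma up_closed_directed: "A \<in> directed \<Longrightarrow> up A \<in> closed_directed"
  using directed_up up_up directed_carrier by blast

text \<open>
  Inversion is an involution that preserves the order, so it permutes the closed directed sets.
\<close>

lemma sinv_image_closed_directed:
  assumes A: "A \<in> closed_directed"
  shows "sinv ` A \<in> closed_directed"
proof -
  have A': "A \<in> directed" and car: "A \<subseteq> carrier S" using A directed_carrier by auto
  have sub: "sinv ` A \<subseteq> carrier S" using car sinv_closed by blast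
  have "up (sinv ` A) \<subseteq> sinv ` A"
  proof
    fix x assume "x \<in> up (sinv ` A)"
    then obtain a where a: "a \<in> A" and le: "sinv a \<preceq> x" by (auto simp: up_closure_def)
    from sinv_mono[OF le] have "a \<preceq> sinv x" using sinv_sinv a car by auto
    then have "sinv x \<in> A" using A a up_mem by blast
    then show "x \<in> sinv ` A" using sinv_sinv le le_carrier by (metis imageI)
  qed
  moreover have "sinv ` A \<in> directed"
    unfolding directed_subsets_def
  proof (intro CollectI conjI ballI sub)
    show "sinv ` A \<noteq> {}" using directed_nonempty[OF A'] by blast
    fix x y assume "x \<in> sinv ` A" "y \<in> sinv ` A"
    then obtain a b where "a \<in> A" "b \<in> A" and xy: "x = sinv a" "y = sinv b" by blast
    then obtain c where "c \<in> A" "c \<preceq> a" "c \<preceq> b" using A' directed_lower_bound by blast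
    then show "\<exists>z\<in>sinv ` A. z \<preceq> x \<and> z \<preceq> y" unfolding xy using sinv_mono by blast
  qed
  ultimately show ?thesis using subset_up[OF sub] by blast
qed

text \<open>
  Over a common lower bound \<open>d\<close> of \<open>a\<close>, \<open>b\<close>, \<open>c\<close>, the product \<open>a b\<^sup>-\<^sup>1 c\<close> lies above
  \<open>d d\<^sup>-\<^sup>1 d = d\<close>.
\<close>

lemma directed_sinv_directed:
  assumes A: "A \<in> directed"
  shows "up (A <#> sinv ` A <#> A) = up A"
proof -
  have car: "A \<subseteq> carrier S" and scar: "sinv ` A \<subseteq> carrier S"
    using directed_carrier[OF A] sinv_closed by auto
  have "A \<subseteq> A <#> sinv ` A <#> A"
  proof
    fix a assume a: "a \<in> A"
    then have "a = a \<otimes> sinv a \<otimes> a" using car sinv by auto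
    then show "a \<in> A <#> sinv ` A <#> A" using a unfolding set_mult_triple_iff by blast
  qed
  moreover have "A <#> sinv ` A <#> A \<subseteq> up A"
  proof
    fix x assume "x \<in> A <#> sinv ` A <#> A"
    then obtain a b c where x: "x = a \<otimes> sinv b \<otimes> c" and abc: "a \<in> A" "b \<in> A" "c \<in> A"
      by (auto simp: set_mult_triple_iff)
    obtain d' where d': "d' \<in> A" "d' \<preceq> a" "d' \<preceq> b" using A abc directed_lower_bound by blast
    obtain d where d: "d \<in> A" "d \<preceq> d'" "d \<preceq> c" using A abc d' directed_lower_bound by blast
    have "d \<otimes> sinv d \<otimes> d \<preceq> x" unfolding x
      using d d' by (blast intro: mult_mono sinv_mono le_trans)
    then have "d \<preceq> x" using d car sinv by auto
    then show "x \<in> up A" using d le_carrier by (auto simp: up_closure_def)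
  qed
  moreover have prod: "A <#> sinv ` A <#> A \<subseteq> carrier S"
    using car scar by (simp add: set_mult_subset_carrier)
  ultimately show ?thesis using up_eq_iff[OF prod car] subset_up[OF prod] by blast
qed

text \<open>
  Half of the uniqueness of inverses. The inclusion \<open>A B A \<subseteq> A\<close> puts \<open>a\<close> and \<open>a b a\<close> into the
  same directed set, which supplies the common lower bound that \<open>inverse_below\<close> needs.
\<close>

lemma sinv_of_quasi_inverse:
  assumes A: "A \<in> closed_directed" and B: "B \<subseteq> carrier S"
    and ABA: "A <#> B <#> A \<subseteq> A"
  shows "B \<subseteq> sinv ` A"
proof
  fix b assume b: "b \<in> B"
  have A': "A \<in> directed" using A by simp
  then obtain a where a: "a \<in> A" using directed_nonempty by blast
  have "a \<otimes> b \<otimes> a \<in> A" using ABA a b set_mult_triple_iff by blast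
  then obtain c where c: "c \<in> A" "c \<preceq> a" "c \<preceq> a \<otimes> b \<otimes> a"
    using A' a directed_lower_bound by blast
  have "sinv c \<preceq> b" using c b B by (intro inverse_below) auto
  moreover have "up (sinv ` A) = sinv ` A" using sinv_image_closed_directed[OF A] by simp
  ultimately show "b \<in> sinv ` A" using up_mem c by blast
qed

lemma closed_directed_inverse_unique:
  assumes A: "A \<in> closed_directed" and B: "B \<in> closed_directed"
    and ABA: "A <#> B <#> A \<subseteq> A" and BAB: "B <#> A <#> B \<subseteq> B"
  shows "B = sinv ` A"
proof
  have car: "A \<subseteq> carrier S" "B \<subseteq> carrier S" using A B directed_carrier by auto
  show "B \<subseteq> sinv ` A" using A car(2) ABA by (rule sinv_of_quasi_inverse)
  have "A \<subseteq> sinv ` B" using B car(1) BAB by (rule sinv_of_quasi_inverse)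
  then show "sinv ` A \<subseteq> B" using sinv_sinv car by fastforce
qed

lemma up_triple:
  assumes "A \<subseteq> carrier S" "B \<subseteq> carrier S" "C \<subseteq> carrier S"
  shows "up (up (A <#> B) <#> C) = up (A <#> B <#> C)"
    and "up (A <#> up (B <#> C)) = up (A <#> (B <#> C))"
  by (rule up_set_mult_cong; use assms in \<open>simp add: up_up up_subset_carrier set_mult_subset_carrier\<close>)+

lemma inverse_semigroup_closed_directed:
  "inverse_semigroup (closed_directed_semigroup S)"
proof
  fix A B assume "A \<in> carrier (closed_directed_semigroup S)"
    "B \<in> carrier (closed_directed_semigroup S)"
  then show "A \<otimes>\<^bsub>closed_directed_semigroup S\<^esub> B \<in> carrier (closed_directed_semigroup S)"
    using up_closed_directed[OF directed_set_mult] by (simp add: closed_directed_semigroup_def)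
next
  fix A B C assume "A \<in> carrier (closed_directed_semigroup S)"
    "B \<in> carrier (closed_directed_semigroup S)" "C \<in> carrier (closed_directed_semigroup S)"
  then have "A \<subseteq> carrier S" "B \<subseteq> carrier S" "C \<subseteq> carrier S"
    using directed_carrier by (auto simp: closed_directed_semigroup_def)
  then show "A \<otimes>\<^bsub>closed_directed_semigroup S\<^esub> B \<otimes>\<^bsub>closed_directed_semigroup S\<^esub> C =
    A \<otimes>\<^bsub>closed_directed_semigroup S\<^esub> (B \<otimes>\<^bsub>closed_directed_semigroup S\<^esub> C)"
    by (simp add: closed_directed_semigroup_def up_triple set_mult_associative)
next
  fix A assume "A \<in> carrier (closed_directed_semigroup S)"
  then have A: "A \<in> closed_directed" by (simp add: closed_directed_semigroup_def)
  let ?I = "sinv ` A"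
  have I: "?I \<in> closed_directed" using A by (rule sinv_image_closed_directed)
  have car: "A \<subseteq> carrier S" and Icar: "?I \<subseteq> carrier S" using A I directed_carrier by auto
  have II: "sinv ` ?I = A" using car sinv_sinv by (force simp: image_image)
  have "up (up (A <#> ?I) <#> A) = A"
    using directed_sinv_directed[of A] A car Icar by (simp add: up_triple)
  moreover have "up (up (?I <#> A) <#> ?I) = ?I"
    using directed_sinv_directed[of ?I] I car Icar II by (simp add: up_triple)
  moreover have "B = ?I" if B: "B \<in> closed_directed"
    and eqs: "up (up (A <#> B) <#> A) = A" "up (up (B <#> A) <#> B) = B" for B
  proof (rule closed_directed_inverse_unique[OF A B])
    have Bcar: "B \<subseteq> carrier S" using B directed_carrier by auto
    have "A <#> B <#> A \<subseteq> up (A <#> B <#> A)" "B <#> A <#> B \<subseteq> up (B <#> A <#> B)"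
      using car Bcar by (simp_all add: subset_up set_mult_subset_carrier)
    then show "A <#> B <#> A \<subseteq> A" "B <#> A <#> B \<subseteq> B"
      using eqs car Bcar by (simp_all add: up_triple)
  qed
  ultimately have "\<exists>!B. B \<in> closed_directed \<and>
      up (up (A <#> B) <#> A) = A \<and> up (up (B <#> A) <#> B) = B"
    using I by (intro ex1I[of _ ?I] conjI) blast+
  then show "\<exists>!B. B \<in> carrier (closed_directed_semigroup S) \<and>
     A \<otimes>\<^bsub>closed_directed_semigroup S\<^esub> B \<otimes>\<^bsub>closed_directed_semigroup S\<^esub> A = A \<and>
     B \<otimes>\<^bsub>closed_directed_semigroup S\<^esub> A \<otimes>\<^bsub>closed_directed_semigroup S\<^esub> B = B"
    by (simp add: closed_directed_semigroup_def)
qed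

section \<open>The isomorphism with Lenz's semigroup\<close>

lemma lenz_rel_iff:
  "(A, B) \<in> lenz_rel S \<longleftrightarrow> A \<in> directed \<and> B \<in> directed \<and> up A = up B"
proof -
  have "lenz_prec S A B \<longleftrightarrow> B \<subseteq> up A" if "B \<in> directed" for A B
    using directed_carrier[OF that] by (auto simp: lenz_prec_def up_closure_def)
  moreover have "up A = up B \<longleftrightarrow> B \<subseteq> up A \<and> A \<subseteq> up B" if "A \<in> directed" "B \<in> directed"
    using up_eq_iff[OF that[THEN directed_carrier]] by blast
  ultimately show ?thesis
    by (cases "A \<in> directed \<and> B \<in> directed") (auto simp only: lenz_rel_def mem_Collect_eq case_prod_conv)
qed

lemma equiv_lenz_rel: "equiv directed (lenz_rel S)"
  by (rule equivI) (auto simp: refl_on_def sym_def trans_def lenz_rel_iff)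

lemma lenz_class_eq_iff:
  "A \<in> directed \<Longrightarrow> B \<in> directed \<Longrightarrow> lenz_rel S `` {A} = lenz_rel S `` {B} \<longleftrightarrow> up A = up B"
  using eq_equiv_class_iff[OF equiv_lenz_rel] by (simp add: lenz_rel_iff)

text \<open>
  The up-closures of \<open>A' B'\<close> and \<open>A B\<close> agree for all representatives, so the union that
  defines the product ranges over copies of a single class.
\<close>

lemma lenz_mult_class:
  assumes A: "A \<in> directed" and B: "B \<in> directed"
  shows "lenz_rel S `` {A} \<otimes>\<^bsub>lenz_semigroup S\<^esub> lenz_rel S `` {B} = lenz_rel S `` {A <#> B}"
proof -
  define X where "X = lenz_rel S `` {A}"
  define Y where "Y = lenz_rel S `` {B}"
  have same: "lenz_rel S `` {A' <#> B'} = lenz_rel S `` {A <#> B}" if "A' \<in> X" "B' \<in> Y" for A' B'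
  proof -
    have AB': "A' \<in> directed" "up A = up A'" "B' \<in> directed" "up B = up B'"
      using that by (simp_all add: X_def Y_def lenz_rel_iff)
    then have "up (A' <#> B') = up (A <#> B)"
      using A B by (intro up_set_mult_cong directed_carrier) simp_all
    then show ?thesis using A B AB' by (simp add: lenz_class_eq_iff directed_set_mult)
  qed
  have "A \<in> X" "B \<in> Y" using A B by (simp_all add: X_def Y_def lenz_rel_iff)
  then have nonempty: "X \<noteq> {}" "Y \<noteq> {}" by blast+
  have "X \<otimes>\<^bsub>lenz_semigroup S\<^esub> Y = (\<Union>A'\<in>X. \<Union>B'\<in>Y. lenz_rel S `` {A' <#> B'})"
    by (simp add: lenz_semigroup_def)
  also have "\<dots> = (\<Union>A'\<in>X. \<Union>B'\<in>Y. lenz_rel S `` {A <#> B})"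
    by (intro SUP_cong refl same)
  also have "\<dots> = lenz_rel S `` {A <#> B}" using nonempty by simp
  finally show ?thesis unfolding X_def Y_def .
qed

lemma class_iso:
  "(\<lambda>A. lenz_rel S `` {A}) \<in> iso (closed_directed_semigroup S) (lenz_semigroup S)"
proof -
  have hom: "lenz_rel S `` {up (A <#> B)} =
      lenz_rel S `` {A} \<otimes>\<^bsub>lenz_semigroup S\<^esub> lenz_rel S `` {B}"
    if "A \<in> directed" "B \<in> directed" for A B
    using that directed_set_mult[OF that]
    by (simp add: lenz_mult_class lenz_class_eq_iff directed_up up_up directed_carrier)
  have inj: "inj_on (\<lambda>A. lenz_rel S `` {A}) closed_directed"
    by (auto simp: inj_on_def lenz_class_eq_iff)
  have "lenz_rel S `` {A} \<in> (\<lambda>A. lenz_rel S `` {A}) ` closed_directed" if A: "A \<in> directed" for A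
  proof
    show "up A \<in> closed_directed" using A by (rule up_closed_directed)
    show "lenz_rel S `` {A} = lenz_rel S `` {up A}"
      using A by (simp add: lenz_class_eq_iff directed_up up_up directed_carrier)
  qed
  then have "(\<lambda>A. lenz_rel S `` {A}) ` closed_directed = directed // lenz_rel S"
    by (auto simp: quotient_def)
  then show ?thesis
    using inj hom unfolding iso_def hom_def bij_betw_def
    by (auto simp: closed_directed_semigroup_def lenz_semigroup_def quotient_def)
qed

end

lemma inverse_semigroup_iso:
  fixes G (structure) and H (structure)
  assumes G: "inverse_semigroup G" and h: "h \<in> iso G H"
  shows "inverse_semigroup H"
proof -
  interpret G: inverse_semigroup G by (rule G)
  have bij: "bij_betw h (carrier G) (carrier H)"
    and mult: "\<And>x y. x \<in> carrier G \<Longrightarrow> y \<in> carrier G \<Longrightarrow> h (x \<otimes>\<^bsub>G\<^esub> y) = h x \<otimes>\<^bsub>H\<^esub> h y"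
    using h by (auto simp: iso_def hom_def)
  have H: "carrier H = h ` carrier G" using bij by (simp add: bij_betw_def)
  have eq: "h x = h y \<longleftrightarrow> x = y" if "x \<in> carrier G" "y \<in> carrier G" for x y
    using bij that by (auto simp: bij_betw_def inj_on_def)
  note simps = mult[symmetric] G.mult_closed
  show ?thesis
  proof
    fix a b c assume "a \<in> carrier H" "b \<in> carrier H" "c \<in> carrier H"
    then show "a \<otimes>\<^bsub>H\<^esub> b \<otimes>\<^bsub>H\<^esub> c = a \<otimes>\<^bsub>H\<^esub> (b \<otimes>\<^bsub>H\<^esub> c)"
      unfolding H by (auto simp: simps G.mult_assoc)
  next
    fix a b assume "a \<in> carrier H" "b \<in> carrier H"
    then show "a \<otimes>\<^bsub>H\<^esub> b \<in> carrier H" unfolding H by (auto simp: simps)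
  next
    fix a assume "a \<in> carrier H"
    then obtain x where x: "x \<in> carrier G" "a = h x" unfolding H by blast
    have transfer: "a \<otimes>\<^bsub>H\<^esub> h z \<otimes>\<^bsub>H\<^esub> a = a \<longleftrightarrow> x \<otimes>\<^bsub>G\<^esub> z \<otimes>\<^bsub>G\<^esub> x = x"
      "h z \<otimes>\<^bsub>H\<^esub> a \<otimes>\<^bsub>H\<^esub> h z = h z \<longleftrightarrow> z \<otimes>\<^bsub>G\<^esub> x \<otimes>\<^bsub>G\<^esub> z = z" if "z \<in> carrier G" for z
      using x that by (simp_all add: simps eq)
    obtain y where y: "y \<in> carrier G" "x \<otimes>\<^bsub>G\<^esub> y \<otimes>\<^bsub>G\<^esub> x = x" "y \<otimes>\<^bsub>G\<^esub> x \<otimes>\<^bsub>G\<^esub> y = y"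
      using ex1_implies_ex[OF G.unique_inverse[OF x(1)]] by (elim exE conjE)
    have uniq: "z = y"
      if "z \<in> carrier G" "x \<otimes>\<^bsub>G\<^esub> z \<otimes>\<^bsub>G\<^esub> x = x" "z \<otimes>\<^bsub>G\<^esub> x \<otimes>\<^bsub>G\<^esub> z = z" for z
      using G.sinv_eqI[OF x(1) that] G.sinv_eqI[OF x(1) y] by simp
    show "\<exists>!b. b \<in> carrier H \<and> a \<otimes>\<^bsub>H\<^esub> b \<otimes>\<^bsub>H\<^esub> a = a \<and> b \<otimes>\<^bsub>H\<^esub> a \<otimes>\<^bsub>H\<^esub> b = b"
    proof (intro ex1I[of _ "h y"] conjI)
      show "h y \<in> carrier H" "a \<otimes>\<^bsub>H\<^esub> h y \<otimes>\<^bsub>H\<^esub> a = a" "h y \<otimes>\<^bsub>H\<^esub> a \<otimes>\<^bsub>H\<^esub> h y = h y"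
        using y by (simp_all only: transfer) (simp add: H)
      fix b assume b: "b \<in> carrier H \<and> a \<otimes>\<^bsub>H\<^esub> b \<otimes>\<^bsub>H\<^esub> a = a \<and> b \<otimes>\<^bsub>H\<^esub> a \<otimes>\<^bsub>H\<^esub> b = b"
      then obtain z where z: "z \<in> carrier G" "b = h z" unfolding H by blast
      have "z = y" using b uniq[OF z(1)] unfolding z(2) transfer[OF z(1)] by simp
      then show "b = h y" using z by simp
    qed
  qed
qed

theorem theorem3p9:
  fixes S :: "('a, 'm) monoid_scheme"
  assumes "inverse_semigroup S"
  shows "inverse_semigroup (closed_directed_semigroup S) \<and>
    inverse_semigroup (lenz_semigroup S) \<and>
    closed_directed_semigroup S \<cong> lenz_semigroup S"
proof -
  interpret inverse_semigroup S by (rule assms)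
  show ?thesis
    using inverse_semigroup_closed_directed class_iso
      inverse_semigroup_iso[OF inverse_semigroup_closed_directed class_iso]
    unfolding is_iso_def by blast
qed

end
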